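(* Let $M$ be a fixed real $n\times n$ normal matrix with simple eigenvalues $\lambda_1,\dots,\lambda_n$, let $P$ be a real random $n\times n$ matrix whose entries are independent and identically distributed with zero mean and finite fourth moments, and let $M(\delta t)=M+\delta t\,P$. Then the total expected force on any eigenvalue is only due to its complex conjugate. That is, for every $i$, with forces evaluated at $\delta t=0$, the expected sum of the forces on $\lambda_i$ exerted by all eigenvalues other than $\lambda_i$ and $\overline{\lambda_i}$ is zero, so that $\mathbb{E}[\ddot\lambda_i]$ equals the expected force of $\overline{\lambda_i}$ on $\lambda_i$ (understood as $0$ if $\lambda_i$ is real).
   Context: A matrix is normal if it is unitarily diagonalizable. $\mathbf{v}_i$ is a unit ($2$-norm) right eigenvector of $M$ for $\lambda_i$, and $\mathbf{u}_i^*$ are the dual left eigenvectors of $M$: $\mathbf{u}_i^*M=\lambda_i\mathbf{u}_i^*$, $\mathbf{u}_j^*\mathbf{v}_i=\delta_{ij}$. Dots denote derivatives with respect to $\delta t$ of the eigenvalues of $M(\delta t)$, evaluated at $\delta t=0$. With $c_{ij}=\mathbf{u}_i^*P\mathbf{v}_j$, one has $$\ddot\lambda_i=2\sum_{j\neq i}\frac{c_{ij}c_{ji}}{\lambda_i-\lambda_j},$$ and the force of $\lambda_j$ on $\lambda_i$ is by definition $\dfrac{2c_{ij}c_{ji}}{\lambda_i-\lambda_j}$. The expectation $\mathbb{E}$ is over the entries of $P$. *)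

theory Defs
  imports
    "HOL-Probability.Probability"
    "HOL-Computational_Algebra.Polynomial"
begin

definition of_real_matrix :: "real^'n^'m \<Rightarrow> complex^'n^'m" where
  "of_real_matrix = map_matrix of_real"

definition cnj_vec :: "complex^'n \<Rightarrow> complex^'n" where
  "cnj_vec x = (\<chi> i. cnj (x $ i))"

definition conj_transpose :: "complex^'n^'m \<Rightarrow> complex^'m^'n" where
  "conj_transpose A = (\<chi> i j. cnj (A $ j $ i))"

text \<open>The product \<open>x\<^sup>* y\<close>, conjugate-linear in the first argument; the library's
  \<open>inner\<close> on \<open>complex^'n\<close> is its real part only.\<close>

definition cdot :: "complex^'n \<Rightarrow> complex^'n \<Rightarrow> complex" where
  "cdot x y = (\<Sum>k\<in>UNIV. cnj (x $ k) * y $ k)"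

definition unitary_matrix :: "complex^'n^'n \<Rightarrow> bool" where
  "unitary_matrix U \<longleftrightarrow> U ** conj_transpose U = mat 1 \<and> conj_transpose U ** U = mat 1"

definition diagonal_matrix :: "complex^'n^'n \<Rightarrow> bool" where
  "diagonal_matrix D \<longleftrightarrow> (\<forall>i j. i \<noteq> j \<longrightarrow> D $ i $ j = 0)"

definition normal_matrix :: "complex^'n^'n \<Rightarrow> bool" where
  "normal_matrix A \<longleftrightarrow>
     (\<exists>U D. unitary_matrix U \<and> diagonal_matrix D \<and> A = U ** D ** conj_transpose U)"

definition right_eigenvector :: "complex^'n^'n \<Rightarrow> complex^'n \<Rightarrow> complex \<Rightarrow> bool" where
  "right_eigenvector A x l \<longleftrightarrow> x \<noteq> 0 \<and> A *v x = l *s x"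

text \<open>The row vector \<open>u\<^sup>*\<close> is a left eigenvector: \<open>u\<^sup>* A = l u\<^sup>*\<close>.\<close>

definition left_eigenvector :: "complex^'n^'n \<Rightarrow> complex^'n \<Rightarrow> complex \<Rightarrow> bool" where
  "left_eigenvector A u l \<longleftrightarrow> u \<noteq> 0 \<and> cnj_vec u v* A = l *s cnj_vec u"

definition eigenvalue :: "complex^'n^'n \<Rightarrow> complex \<Rightarrow> bool" where
  "eigenvalue A l \<longleftrightarrow> (\<exists>x. right_eigenvector A x l)"

definition char_poly :: "complex^'n^'n \<Rightarrow> complex poly" where
  "char_poly A = det (\<chi> i j. (if i = j then [:0, 1:] else 0) - [:A $ i $ j:])"

definition simple_eigenvalue :: "complex^'n^'n \<Rightarrow> complex \<Rightarrow> bool" where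
  "simple_eigenvalue A l \<longleftrightarrow> eigenvalue A l \<and> order l (char_poly A) = 1"

text \<open>\<open>f\<close> follows the eigenvalue \<open>l\<close> of \<open>A\<close> under the perturbation \<open>A + t B\<close>, for
  small real \<open>t\<close>.  If \<open>l\<close> is simple, such an \<open>f\<close> exists and its germ at \<open>0\<close> is unique.\<close>

definition eigenvalue_branch ::
    "real^'n^'n \<Rightarrow> real^'n^'n \<Rightarrow> complex \<Rightarrow> (real \<Rightarrow> complex) \<Rightarrow> bool" where
  "eigenvalue_branch A B l f \<longleftrightarrow>
     f 0 = l \<and>
     (\<exists>e>0. continuous_on {-e<..<e} f \<and>
        (\<forall>t\<in>{-e<..<e}. eigenvalue (of_real_matrix (A + t *\<^sub>R B)) (f t)))"

definition has_second_vector_derivative ::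
    "(real \<Rightarrow> 'a::real_normed_vector) \<Rightarrow> 'a \<Rightarrow> real \<Rightarrow> bool" where
  "has_second_vector_derivative f d x \<longleftrightarrow>
     (\<exists>f'. (\<forall>\<^sub>F t in nhds x. (f has_vector_derivative f' t) (at t)) \<and>
           (f' has_vector_derivative d) (at x))"

text \<open>The coefficient \<open>c\<^sub>i\<^sub>j = u\<^sub>i\<^sup>* B v\<^sub>j\<close> and the force of the \<open>j\<close>-th on the
  \<open>i\<close>-th eigenvalue, for \<open>j \<noteq> i\<close>.\<close>

definition coupling ::
    "('n \<Rightarrow> complex^'n) \<Rightarrow> ('n \<Rightarrow> complex^'n) \<Rightarrow> real^'n^'n \<Rightarrow> 'n \<Rightarrow> 'n \<Rightarrow> complex" where
  "coupling u v B i j = cdot (u i) (of_real_matrix B *v v j)"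

definition force ::
    "('n \<Rightarrow> complex) \<Rightarrow> ('n \<Rightarrow> complex^'n) \<Rightarrow> ('n \<Rightarrow> complex^'n) \<Rightarrow> real^'n^'n \<Rightarrow>
     'n \<Rightarrow> 'n \<Rightarrow> complex" where
  "force l u v B i j = 2 * coupling u v B i j * coupling u v B j i / (l i - l j)"

end

theory Submission
  imports Defs
begin

text \<open>
  When the eigenvalues are distinct, second-order perturbation theory gives the second derivative
  of each of them as the sum of the forces on it. This holds along every continuous branch of eigenvalues
  (\<open>eigenvalue_branch_second_derivative\<close>). In a basis of eigenvectors the perturbed matrix is
  \<open>diag d + t C\<close>, and the spectral gap controls its eigenvectors near \<open>t = 0\<close>
  (\<open>eigenvector_branch\<close>). Pairing right with left eigenvectors turns this control into the first
  derivative of the eigenvalue near 0 and the second derivative at 0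
  (\<open>eigenvalue_second_derivative\<close>).

  The expectation of \<open>c\<^sub>i\<^sub>j c\<^sub>j\<^sub>i\<close> for independent centred entries of common variance \<open>s\<close> is
  \<open>s (\<Sum>a. cnj (u\<^sub>i a) cnj (u\<^sub>j a)) (\<Sum>b. v\<^sub>j b v\<^sub>i b)\<close> (\<open>expected_force\<close>). The last factor is the
  scalar product of \<open>cnj v\<^sub>j\<close> and \<open>v\<^sub>i\<close>. As \<open>M\<close> is real, \<open>cnj v\<^sub>j\<close> is an eigenvector for the
  conjugate of \<open>l\<^sub>j\<close> (\<open>real_matrix_cnj_eigenvector\<close>); as \<open>M\<close> is normal, the product vanishes
  unless that conjugate equals \<open>l\<^sub>i\<close> (\<open>normal_eigenvectors_orthogonal\<close>). So the only force whose
  expectation can be nonzero is that of the complex conjugate of \<open>l\<^sub>i\<close>. This conjugate is itself an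
  eigenvalue of \<open>M\<close>, and if \<open>l\<^sub>i\<close> is real it is \<open>l\<^sub>i\<close>, which exerts no force on itself.
\<close>

section \<open>Preliminaries\<close>

lemma has_vector_derivative_if_slope:
  fixes f :: "real \<Rightarrow> 'a::real_normed_vector"
  assumes slope: "\<forall>\<^sub>F t in at a. f t - f a = (t - a) *\<^sub>R h t"
    and lim: "(h \<longlongrightarrow> D) (at a)"
  shows "(f has_vector_derivative D) (at a)"
  unfolding has_vector_derivative_def has_derivative_iff_norm
proof
  show "bounded_linear (\<lambda>x. x *\<^sub>R D)" by (rule bounded_linear_scaleR_left)
  have "((\<lambda>t. norm (h t - D)) \<longlongrightarrow> 0) (at a)"
    using lim by (simp add: LIM_zero tendsto_norm_zero)
  moreover have "\<forall>\<^sub>F t in at a. norm (h t - D) = norm (f t - f a - (t - a) *\<^sub>R D) / norm (t - a)"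
    using slope eventually_neq_at_within[of a a UNIV]
  proof eventually_elim
    case (elim t)
    then have "f t - f a - (t - a) *\<^sub>R D = (t - a) *\<^sub>R (h t - D)"
      by (simp add: scaleR_diff_right)
    then show ?case using elim by simp
  qed
  ultimately show "((\<lambda>t. norm (f t - f a - (t - a) *\<^sub>R D) / norm (t - a)) \<longlongrightarrow> 0) (at a)"
    by (rule Lim_transform_eventually)
qed

text \<open>A square matrix and its transpose are singular together, since their determinants agree. In
  the perturbation argument this provides left eigenvectors.\<close>

lemma transpose_eigenvector_exists:
  fixes A :: "'a::field^'n^'n"
  assumes "x \<noteq> 0" "A *v x = z *s x"
  obtains y where "y \<noteq> 0" "transpose A *v y = z *s y"
proof -
  define N where "N = A - mat z"
  have mat: "mat c *v w = c *s w" for c and w :: "'a^'n"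
    by (simp add: vec_eq_iff matrix_vector_mult_def mat_def if_distrib[of "\<lambda>a. a * _"] cong: if_cong)
  have "N *v x = 0"
    using assms by (simp add: N_def matrix_vector_mult_diff_rdistrib mat)
  with \<open>x \<noteq> 0\<close> have "\<not> invertible N"
    unfolding invertible_left_inverse matrix_left_invertible_ker by auto
  then have "\<not> invertible (transpose N)"
    by (simp add: invertible_det_nz det_transpose)
  then obtain y where y: "y \<noteq> 0" "transpose N *v y = 0"
    unfolding invertible_left_inverse matrix_left_invertible_ker by auto
  have "transpose N = transpose A - mat z"
    by (auto simp: N_def transpose_def mat_def vec_eq_iff)
  then have "transpose A *v y = z *s y"
    using y(2) by (simp add: matrix_vector_mult_diff_rdistrib mat del: transpose_matrix_vector)
  with y(1) that show thesis by blast
qed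

section \<open>Perturbation of a diagonal matrix with distinct entries\<close>

text \<open>The matrix \<open>diag d + t C\<close>: what \<open>A + t B\<close> becomes in a basis of eigenvectors of \<open>A\<close>.\<close>

definition perturbed_diagonal :: "('n \<Rightarrow> complex) \<Rightarrow> complex^'n^'n \<Rightarrow> real \<Rightarrow> complex^'n^'n" where
  "perturbed_diagonal d C t = (\<chi> j k. (if j = k then d j else 0) + of_real t * C $ j $ k)"

lemma perturbed_diagonal_mult_component:
  "(perturbed_diagonal d C t *v x) $ j = d j * x $ j + of_real t * (C *v x) $ j"
  by (simp add: perturbed_diagonal_def matrix_vector_mult_def distrib_right sum.distrib
      sum_distrib_left mult.assoc if_distrib[of "\<lambda>a. a * _"] cong: if_cong)

lemma transpose_perturbed_diagonal:
  "transpose (perturbed_diagonal d C t) = perturbed_diagonal d (transpose C) t"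
  by (auto simp: perturbed_diagonal_def transpose_def vec_eq_iff)

text \<open>Away from coordinate \<open>i\<close>, the operator \<open>z - diag d\<close> is bounded below by the spectral gap \<open>g\<close>,
  and for small \<open>t\<close> the perturbation \<open>t C\<close> costs at most half of that. A vector that vanishes
  at \<open>i\<close> is therefore controlled by its residual, of which the \<open>i\<close>-th component is left out.
  This single estimate shows both that an eigenvector cannot vanish at \<open>i\<close> and that the
  eigenvector normalised at \<open>i\<close> depends continuously on \<open>t\<close>.\<close>

lemma gap_bound:
  fixes C :: "complex^'n^'n" and w :: "complex^'n"
  assumes gap: "\<And>j. j \<noteq> i \<Longrightarrow> g \<le> norm (z - d j)"
    and small: "\<bar>t\<bar> * (\<Sum>j\<in>UNIV. \<Sum>k\<in>UNIV. norm (C $ j $ k)) \<le> g / 2"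
    and zero: "w $ i = 0"
  shows "g / 2 * (\<Sum>j\<in>UNIV. norm (w $ j))
    \<le> (\<Sum>j\<in>-{i}. norm ((z - d j) * w $ j - of_real t * (C *v w) $ j))" (is "_ \<le> ?R")
proof -
  define N where "N = (\<Sum>j\<in>UNIV. norm (w $ j))"
  define K where "K j = (\<Sum>k\<in>UNIV. norm (C $ j $ k))" for j
  have N0: "0 \<le> N" by (simp add: N_def sum_nonneg)
  have K0: "0 \<le> K j" for j by (simp add: K_def sum_nonneg)
  have Cw: "norm ((C *v w) $ j) \<le> K j * N" for j
  proof -
    have "norm ((C *v w) $ j) \<le> (\<Sum>k\<in>UNIV. norm (C $ j $ k * w $ k))"
      by (simp add: matrix_vector_mult_def norm_sum)
    also have "\<dots> \<le> (\<Sum>k\<in>UNIV. norm (C $ j $ k) * N)"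
      by (intro sum_mono) (auto simp: norm_mult N_def intro!: mult_left_mono member_le_sum)
    finally show ?thesis by (simp add: K_def sum_distrib_right)
  qed
  have N_off: "N = (\<Sum>j\<in>-{i}. norm (w $ j))"
    unfolding N_def by (rule sum.mono_neutral_right) (auto simp: zero)
  have "g * N = (\<Sum>j\<in>-{i}. g * norm (w $ j))"
    by (simp add: N_off sum_distrib_left)
  also have "\<dots> \<le> (\<Sum>j\<in>-{i}. norm ((z - d j) * w $ j - of_real t * (C *v w) $ j) + \<bar>t\<bar> * (K j * N))"
  proof (rule sum_mono)
    fix j assume "j \<in> -{i}"
    then have "g * norm (w $ j) \<le> norm ((z - d j) * w $ j)"
      using gap[of j] by (simp add: norm_mult mult_right_mono)
    also have "\<dots> \<le> norm ((z - d j) * w $ j - of_real t * (C *v w) $ j)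
        + norm (of_real t * (C *v w) $ j)"
      using norm_triangle_ineq[of "(z - d j) * w $ j - of_real t * (C *v w) $ j" "of_real t * (C *v w) $ j"]
      by simp
    also have "norm (of_real t * (C *v w) $ j) \<le> \<bar>t\<bar> * (K j * N)"
      using Cw[of j] by (simp add: norm_mult mult_left_mono)
    finally show "g * norm (w $ j)
        \<le> norm ((z - d j) * w $ j - of_real t * (C *v w) $ j) + \<bar>t\<bar> * (K j * N)" by simp
  qed
  also have "\<dots> = ?R + \<bar>t\<bar> * (\<Sum>j\<in>-{i}. K j) * N"
    by (simp only: sum.distrib sum_distrib_left[symmetric] sum_distrib_right[symmetric] mult.assoc)
  finally have bound: "g * N \<le> ?R + \<bar>t\<bar> * (\<Sum>j\<in>-{i}. K j) * N" .
  have "(\<Sum>j\<in>-{i}. K j) \<le> (\<Sum>j\<in>UNIV. K j)"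
    by (rule sum_mono2) (auto simp: K0)
  then have "\<bar>t\<bar> * (\<Sum>j\<in>-{i}. K j) \<le> \<bar>t\<bar> * (\<Sum>j\<in>UNIV. K j)"
    by (rule mult_left_mono) simp
  also have "\<dots> \<le> g / 2" using small by (simp only: K_def)
  finally have "\<bar>t\<bar> * (\<Sum>j\<in>-{i}. K j) * N \<le> g / 2 * N"
    using N0 by (rule mult_right_mono)
  with bound have "g * N \<le> ?R + g / 2 * N" by linarith
  then show ?thesis unfolding N_def by simp
qed

text \<open>Along a continuous branch \<open>f\<close> of eigenvalues the eigenvectors can be normalised to have
  \<open>i\<close>-th coordinate 1. The other coordinates then satisfy
  \<open>(f t - d j) x\<^sub>j = t (C x)\<^sub>j\<close>; dividing by \<open>t\<close> and letting \<open>t\<close> tend to 0 gives their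
  derivative at 0.\<close>

lemma eigenvector_branch:
  fixes C :: "complex^'n^'n"
  assumes inj: "inj d" and e: "0 < e" and cont: "continuous_on {-e<..<e} f" and f0: "f 0 = d i"
    and eig: "\<And>t. t \<in> {-e<..<e} \<Longrightarrow> \<exists>x. x \<noteq> 0 \<and> perturbed_diagonal d C t *v x = f t *s x"
  obtains e' X where "0 < e'" "e' \<le> e" "\<And>t. X t $ i = 1"
    "\<And>t. t \<in> {-e'<..<e'} \<Longrightarrow> perturbed_diagonal d C t *v X t = f t *s X t"
    "\<And>t. t \<in> {-e'<..<e'} \<Longrightarrow> isCont X t"
    "\<And>j. ((\<lambda>t. X t $ j) has_vector_derivative (if j = i then 0 else C $ j $ i / (d i - d j))) (at 0)"
    "X 0 = axis i 1"
proof -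
  define K where "K = (\<Sum>j\<in>UNIV. \<Sum>k\<in>UNIV. norm (C $ j $ k))"
  have K0: "0 \<le> K" by (simp add: K_def sum_nonneg)
  \<comment> \<open>The number 1 only keeps the set nonempty when \<open>i\<close> is the sole index; halving leaves the other half of each gap for \<open>f t\<close> to move in.\<close>
  define g where "g = Min (insert 1 ((\<lambda>j. norm (d i - d j) / 2) ` (-{i})))"
  have g0: "0 < g" using inj by (auto simp: g_def inj_eq)
  have g_le: "2 * g \<le> norm (d i - d j)" if "j \<noteq> i" for j
  proof -
    have "g \<le> norm (d i - d j) / 2" unfolding g_def using that by (intro Min_le) auto
    then show ?thesis by simp
  qed
  have fcont: "isCont f t" if "t \<in> {-e<..<e}" for t
    using cont that by (simp add: continuous_on_eq_continuous_at)
  then have "isCont f 0" using e by simp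
  then obtain e1 where e1: "0 < e1" "\<And>t. \<bar>t\<bar> < e1 \<Longrightarrow> norm (f t - d i) < g"
    using g0 unfolding continuous_at_eps_delta dist_norm f0 by auto
  \<comment> \<open>The last bound makes the perturbation at most \<open>g / 2\<close>; the summand 1 avoids division by zero.\<close>
  define e' where "e' = min e (min e1 (g / (2 * (K + 1))))"
  have e'0: "0 < e'" using e e1 g0 K0 by (simp add: e'_def)
  have in_e: "t \<in> {-e<..<e}" if "t \<in> {-e'<..<e'}" for t using that by (auto simp: e'_def)
  have gap: "g \<le> norm (f t - d j)" if t: "t \<in> {-e'<..<e'}" and "j \<noteq> i" for t j
  proof -
    have "norm (f t - d i) < g" using t by (intro e1) (auto simp: e'_def)
    then show ?thesis using g_le[OF \<open>j \<noteq> i\<close>] norm_triangle_ineq[of "d i - f t" "f t - d j"]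
      by (simp add: norm_minus_commute)
  qed
  have small: "\<bar>t\<bar> * K \<le> g / 2" if t: "t \<in> {-e'<..<e'}" for t
  proof -
    have "\<bar>t\<bar> * K \<le> g / (2 * (K + 1)) * (K + 1)"
      using t K0 g0 by (intro mult_mono) (auto simp: e'_def)
    also have "\<dots> = g / 2" using K0 by (simp add: divide_simps)
    finally show ?thesis .
  qed
  have bound: "norm (w $ j)
      \<le> 2 / g * (\<Sum>j\<in>-{i}. norm ((f t - d j) * w $ j - of_real t * (C *v w) $ j))"
    if "t \<in> {-e'<..<e'}" "w $ i = 0" for t w j
  proof -
    have "norm (w $ j) \<le> (\<Sum>j\<in>UNIV. norm (w $ j))" by (rule member_le_sum) auto
    also have "\<dots> \<le> 2 / g * (\<Sum>j\<in>-{i}. norm ((f t - d j) * w $ j - of_real t * (C *v w) $ j))"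
      using gap_bound[of i g "f t" d t C w] gap small that g0 by (simp add: K_def field_simps)
    finally show ?thesis .
  qed
  have ex: "\<exists>x. x $ i = 1 \<and> perturbed_diagonal d C t *v x = f t *s x" if t: "t \<in> {-e'<..<e'}" for t
  proof -
    obtain x where x: "x \<noteq> 0" "perturbed_diagonal d C t *v x = f t *s x"
      using eig[OF in_e[OF t]] by blast
    have "x $ i \<noteq> 0"
    proof
      assume "x $ i = 0"
      moreover have "(f t - d j) * x $ j - of_real t * (C *v x) $ j = 0" for j
        using arg_cong[OF x(2), of "\<lambda>y. y $ j"]
        by (simp add: perturbed_diagonal_mult_component algebra_simps)
      ultimately have "norm (x $ j) \<le> 0" for j using bound[OF t, of x j] by simp
      then have "x = 0" by (simp add: vec_eq_iff)
      with x(1) show False by blast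
    qed
    then show ?thesis
      by (intro exI[of _ "inverse (x $ i) *s x"])
        (simp add: vector_scalar_commute x(2) vector_smult_assoc mult.commute)
  qed
  \<comment> \<open>The default value \<open>axis i 1\<close> keeps the \<open>i\<close>-th coordinate equal to 1 for all \<open>t\<close>, so that it has derivative 0 without a side condition on \<open>t\<close>.\<close>
  define X where "X t = (if t \<in> {-e'<..<e'}
    then SOME x. x $ i = 1 \<and> perturbed_diagonal d C t *v x = f t *s x else axis i 1)" for t
  have X: "X t $ i = 1 \<and> perturbed_diagonal d C t *v X t = f t *s X t" if "t \<in> {-e'<..<e'}" for t
    using someI_ex[OF ex[OF that]] that by (simp add: X_def)
  have Xi: "X t $ i = 1" for t using X by (cases "t \<in> {-e'<..<e'}") (auto simp: X_def)
  have Xj: "(f t - d j) * X t $ j = of_real t * (C *v X t) $ j" if "t \<in> {-e'<..<e'}" for t j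
    using arg_cong[OF conjunct2[OF X[OF that]], of "\<lambda>y. y $ j"]
    by (simp add: perturbed_diagonal_mult_component algebra_simps)
  have contX: "isCont X s" if s: "s \<in> {-e'<..<e'}" for s
    unfolding isCont_def
  proof (rule vec_tendstoI)
    fix j
    define R where "R t = (\<Sum>j\<in>-{i}. norm ((f t - f s) * X s $ j - of_real (t - s) * (C *v X s) $ j))" for t
    have near: "\<forall>\<^sub>F t in at s. t \<in> {-e'<..<e'}"
      using s by (intro eventually_at_in_open') auto
    have "(f \<longlongrightarrow> f s) (at s)" using fcont[OF in_e[OF s]] by (simp add: isCont_def)
    then have "((\<lambda>t. 2 / g * R t) \<longlongrightarrow> 2 / g *
        (\<Sum>j\<in>-{i}. norm ((f s - f s) * X s $ j - of_real (s - s) * (C *v X s) $ j))) (at s)"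
      unfolding R_def by (intro tendsto_intros)
    then have "((\<lambda>t. 2 / g * R t) \<longlongrightarrow> 0) (at s)" by simp
    moreover have "\<forall>\<^sub>F t in at s. norm (X t $ j - X s $ j) \<le> 2 / g * R t"
      using near
    proof eventually_elim
      case (elim t)
      \<comment> \<open>The difference of two eigenvectors is an eigenvector up to a residual that vanishes as \<open>t\<close> tends to \<open>s\<close>.\<close>
      have "(f t - d k) * (X t - X s) $ k - of_real t * (C *v (X t - X s)) $ k
        = - ((f t - f s) * X s $ k - of_real (t - s) * (C *v X s) $ k)" for k
        using Xj[OF elim, of k] Xj[OF s, of k]
        by (simp add: matrix_vector_mult_diff_distrib algebra_simps)
      then show ?case
        using bound[OF elim, of "X t - X s" j] Xi by (simp only: norm_minus_cancel R_def) simp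
    qed
    ultimately have "((\<lambda>t. X t $ j - X s $ j) \<longlongrightarrow> 0) (at s)"
      by (rule Lim_null_comparison[rotated])
    then show "((\<lambda>t. X t $ j) \<longlongrightarrow> X s $ j) (at s)" by (rule LIM_zero_cancel)
  qed
  have zero: "0 \<in> {-e'<..<e'}" using e'0 by simp
  have X0: "X 0 = axis i 1"
  proof -
    have "X 0 $ j = 0" if "j \<noteq> i" for j
      using Xj[OF zero, of j] inj that by (simp add: f0 inj_eq)
    then show ?thesis using Xi by (simp add: vec_eq_iff axis_def)
  qed
  have deriv: "((\<lambda>t. X t $ j) has_vector_derivative C $ j $ i / (d i - d j)) (at 0)" if j: "j \<noteq> i" for j
  proof (rule has_vector_derivative_if_slope)
    have "\<forall>\<^sub>F t in at 0. t \<in> {-e'<..<e'}"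
      using zero by (intro eventually_at_in_open') auto
    then show "\<forall>\<^sub>F t in at 0. X t $ j - X 0 $ j = (t - 0) *\<^sub>R ((C *v X t) $ j / (f t - d j))"
    proof eventually_elim
      case (elim t)
      have "f t - d j \<noteq> 0" using gap[OF elim j] g0 by auto
      then have "X t $ j = (f t - d j) * X t $ j / (f t - d j)" by simp
      also have "\<dots> = of_real t * ((C *v X t) $ j / (f t - d j))"
        by (simp only: Xj[OF elim, of j] times_divide_eq_right)
      finally show ?case using j by (simp add: X0 axis_def scaleR_conv_of_real)
    qed
    have "(X \<longlongrightarrow> X 0) (at 0)"
      using contX[OF zero] by (simp add: isCont_def)
    then have "((\<lambda>t. (C *v X t) $ j / (f t - d j)) \<longlongrightarrow> (C *v X 0) $ j / (f 0 - d j)) (at 0)"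
      using \<open>isCont f 0\<close> inj j unfolding matrix_vector_mult_def
      by (auto simp: isCont_def f0 inj_eq intro!: tendsto_intros)
    then show "((\<lambda>t. (C *v X t) $ j / (f t - d j)) \<longlongrightarrow> C $ j $ i / (d i - d j)) (at 0)"
      by (simp add: X0 f0 matrix_vector_mult_def axis_def if_distrib[of "\<lambda>a. _ * a"] cong: if_cong)
  qed
  show thesis
  proof (rule that[of e' X, OF e'0 _ Xi conjunct2[OF X] contX _ X0])
    show "e' \<le> e" by (simp add: e'_def)
    show "((\<lambda>t. X t $ j) has_vector_derivative (if j = i then 0 else C $ j $ i / (d i - d j))) (at 0)" for j
      using deriv[of j] Xi by (cases "j = i") auto
  qed
qed

text \<open>Let \<open>X t\<close> and \<open>Y t\<close> be the normalised right and left eigenvectors. Pairing the equation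
  for \<open>X t\<close> with \<open>Y s\<close> cancels the diagonal part:
  \<open>(f t - f s) (Y s \<cdot> X t) = (t - s) (Y s \<cdot> C X t)\<close>. Hence continuity of \<open>X\<close> alone makes \<open>f\<close>
  differentiable near 0, with \<open>f' s = (Y s \<cdot> C X s) / (Y s \<cdot> X s)\<close>. At 0 the first derivatives
  of \<open>X\<close> and \<open>Y\<close> are known, so this formula can be differentiated there. The denominator is
  stationary at 0, because the derivatives of \<open>X\<close> and \<open>Y\<close> vanish at \<open>i\<close> while
  \<open>X 0 = Y 0 = axis i 1\<close>; the two halves of the derivative of the numerator are equal, which
  is the origin of the factor 2.\<close>

lemma eigenvalue_second_derivative:
  fixes C :: "complex^'n^'n"
  assumes inj: "inj d" and e: "0 < e" and cont: "continuous_on {-e<..<e} f" and f0: "f 0 = d i"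
    and eig: "\<And>t. t \<in> {-e<..<e} \<Longrightarrow> \<exists>x. x \<noteq> 0 \<and> perturbed_diagonal d C t *v x = f t *s x"
  shows "has_second_vector_derivative f (\<Sum>j\<in>-{i}. 2 * C $ i $ j * C $ j $ i / (d i - d j)) 0"
proof -
  obtain e1 X where e1: "0 < e1" "e1 \<le> e" and Xi: "\<And>t. X t $ i = 1"
    and Xeig: "\<And>t. t \<in> {-e1<..<e1} \<Longrightarrow> perturbed_diagonal d C t *v X t = f t *s X t"
    and Xcont: "\<And>t. t \<in> {-e1<..<e1} \<Longrightarrow> isCont X t"
    and Xderiv: "\<And>j. ((\<lambda>t. X t $ j) has_vector_derivative (if j = i then 0 else C $ j $ i / (d i - d j))) (at 0)"
    and X0: "X 0 = axis i 1"
    by (rule eigenvector_branch[OF inj e cont f0 eig]) (assumption, (rule that; assumption))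
  have eigT: "\<exists>y. y \<noteq> 0 \<and> perturbed_diagonal d (transpose C) t *v y = f t *s y"
    if t: "t \<in> {-e<..<e}" for t
  proof -
    obtain x where "x \<noteq> 0" "perturbed_diagonal d C t *v x = f t *s x"
      using eig[OF t] by blast
    then obtain y where "y \<noteq> 0" "transpose (perturbed_diagonal d C t) *v y = f t *s y"
      by (rule transpose_eigenvector_exists)
    then show ?thesis unfolding transpose_perturbed_diagonal by blast
  qed
  obtain e2 Y where e2: "0 < e2" "e2 \<le> e" and Yi: "\<And>t. Y t $ i = 1"
    and Yeig: "\<And>t. t \<in> {-e2<..<e2} \<Longrightarrow> perturbed_diagonal d (transpose C) t *v Y t = f t *s Y t"
    and Ycont: "\<And>t. t \<in> {-e2<..<e2} \<Longrightarrow> isCont Y t"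
    and Yderiv: "\<And>j. ((\<lambda>t. Y t $ j) has_vector_derivative
                   (if j = i then 0 else transpose C $ j $ i / (d i - d j))) (at 0)"
    and Y0: "Y 0 = axis i 1"
    by (rule eigenvector_branch[OF inj e cont f0 eigT]) (assumption, (rule that; assumption))
  define pair :: "complex^'n \<Rightarrow> complex^'n \<Rightarrow> complex" where "pair y x = (\<Sum>j\<in>UNIV. y $ j * x $ j)" for y x
  have pair_transpose: "pair (transpose C *v y) x = pair y (C *v x)" for x y
    unfolding pair_def matrix_vector_mult_def transpose_def sum_distrib_left sum_distrib_right vec_lambda_beta
    by (subst sum.swap) (simp add: mult_ac)
  have pair_axis_left: "pair (axis i 1) x = x $ i" for x
    by (simp add: pair_def axis_def if_distrib[of "\<lambda>a. a * _"] cong: if_cong)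
  have pair_tendsto: "((\<lambda>t. pair (y t) (x t)) \<longlongrightarrow> pair y' x') F"
    if "(y \<longlongrightarrow> y') F" "(x \<longlongrightarrow> x') F" for x y x' y' and F :: "real filter"
    unfolding pair_def using that by (intro tendsto_intros)
  have C_tendsto: "((\<lambda>t. C *v x t) \<longlongrightarrow> C *v x') F" if "(x \<longlongrightarrow> x') F" for x x' and F :: "real filter"
    unfolding matrix_vector_mult_def using that
    by (intro vec_tendstoI) (auto intro!: tendsto_intros)
  have increment: "(f t - f s) * pair (Y s) (X t) = of_real (t - s) * pair (Y s) (C *v X t)"
    if "t \<in> {-e1<..<e1}" "s \<in> {-e2<..<e2}" for s t
  proof -
    have "f t * pair (Y s) (X t) = pair (Y s) (perturbed_diagonal d C t *v X t)"
      by (simp add: Xeig[OF that(1)] pair_def sum_distrib_left mult_ac)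
    also have "\<dots> = (\<Sum>j\<in>UNIV. d j * Y s $ j * X t $ j) + of_real t * pair (Y s) (C *v X t)"
      by (simp add: pair_def perturbed_diagonal_mult_component distrib_left sum.distrib
          sum_distrib_left mult_ac)
    finally have right: "f t * pair (Y s) (X t) = \<dots>" .
    have "f s * pair (Y s) (X t) = pair (perturbed_diagonal d (transpose C) s *v Y s) (X t)"
      by (simp add: Yeig[OF that(2)] pair_def sum_distrib_left mult_ac)
    also have "\<dots> = (\<Sum>j\<in>UNIV. d j * Y s $ j * X t $ j) + of_real s * pair (transpose C *v Y s) (X t)"
      by (simp add: pair_def perturbed_diagonal_mult_component distrib_left sum.distrib
          sum_distrib_left mult_ac)
    finally show ?thesis using right by (simp only: pair_transpose) (simp add: algebra_simps)
  qed
  define p where "p t = pair (Y t) (C *v X t)" for t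
  define q where "q t = pair (Y t) (X t)" for t
  have q0: "q 0 = 1" by (simp add: q_def X0 Y0 pair_axis_left)
  have Xlim: "(X \<longlongrightarrow> X t) (at t)" if "t \<in> {-e1<..<e1}" for t
    using Xcont[OF that] by (simp add: isCont_def)
  have Ylim: "(Y \<longlongrightarrow> Y t) (at t)" if "t \<in> {-e2<..<e2}" for t
    using Ycont[OF that] by (simp add: isCont_def)
  have "(q \<longlongrightarrow> q 0) (at 0)"
    unfolding q_def using e1 e2 by (intro pair_tendsto Xlim Ylim) auto
  then have "\<forall>\<^sub>F t in at 0. q t \<noteq> 0"
    by (rule tendsto_imp_eventually_ne) (simp add: q0)
  then have q_ne: "\<forall>\<^sub>F t in nhds 0. q t \<noteq> 0"
    using q0 by (simp add: eventually_nhds_conv_at)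
  have deriv: "(f has_vector_derivative p s / q s) (at s)"
    if s1: "s \<in> {-e1<..<e1}" and s2: "s \<in> {-e2<..<e2}" and "q s \<noteq> 0" for s
  proof (rule has_vector_derivative_if_slope)
    have lim: "((\<lambda>t. pair (Y s) (X t)) \<longlongrightarrow> q s) (at s)"
      unfolding q_def by (intro pair_tendsto Xlim s1 tendsto_const)
    then show "((\<lambda>t. pair (Y s) (C *v X t) / pair (Y s) (X t)) \<longlongrightarrow> p s / q s) (at s)"
      unfolding p_def using \<open>q s \<noteq> 0\<close>
      by (intro tendsto_divide pair_tendsto C_tendsto Xlim s1 tendsto_const)
    have "\<forall>\<^sub>F t in at s. pair (Y s) (X t) \<noteq> 0"
      using lim \<open>q s \<noteq> 0\<close> by (rule tendsto_imp_eventually_ne)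
    moreover have "\<forall>\<^sub>F t in at s. t \<in> {-e1<..<e1}"
      using s1 by (intro eventually_at_in_open') auto
    ultimately show "\<forall>\<^sub>F t in at s. f t - f s
        = (t - s) *\<^sub>R (pair (Y s) (C *v X t) / pair (Y s) (X t))"
    proof eventually_elim
      case (elim t)
      then have "f t - f s = (f t - f s) * pair (Y s) (X t) / pair (Y s) (X t)" by simp
      also have "\<dots> = of_real (t - s) * (pair (Y s) (C *v X t) / pair (Y s) (X t))"
        by (simp only: increment[OF elim(2) s2] times_divide_eq_right)
      finally show ?case by (simp only: scaleR_conv_of_real)
    qed
  qed
  define S where "S = (\<Sum>j\<in>-{i}. C $ i $ j * C $ j $ i / (d i - d j))"
  define X' where "X' j = (if j = i then 0 else C $ j $ i / (d i - d j))" for j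
  define Y' where "Y' j = (if j = i then 0 else C $ i $ j / (d i - d j))" for j
  have dX: "((\<lambda>t. X t $ j) has_vector_derivative X' j) (at 0)" for j
    using Xderiv by (simp add: X'_def)
  have dY: "((\<lambda>t. Y t $ j) has_vector_derivative Y' j) (at 0)" for j
    using Yderiv[of j] by (cases "j = i") (simp_all add: Y'_def transpose_def)
  have dCX: "((\<lambda>t. (C *v X t) $ j) has_vector_derivative (\<Sum>k\<in>UNIV. C $ j $ k * X' k)) (at 0)" for j
    unfolding matrix_vector_mult_def vec_lambda_beta
    by (intro has_vector_derivative_sum has_vector_derivative_mult_right dX)
  have axis_sum: "(\<Sum>j\<in>UNIV. axis i (1::complex) $ j * c j) = c i"
    "(\<Sum>j\<in>UNIV. c j * axis i (1::complex) $ j) = c i" for c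
    by (simp_all add: axis_def if_distrib[of "\<lambda>a. a * _"] if_distrib[of "\<lambda>a. _ * a"] cong: if_cong)
  have S_X: "(\<Sum>k\<in>UNIV. C $ i $ k * X' k) = S"
    unfolding S_def X'_def by (rule sum.mono_neutral_cong_right) auto
  have S_Y: "(\<Sum>j\<in>UNIV. Y' j * C $ j $ i) = S"
    unfolding S_def Y'_def by (rule sum.mono_neutral_cong_right) auto
  have "(p has_vector_derivative (\<Sum>j\<in>UNIV. Y 0 $ j * (\<Sum>k\<in>UNIV. C $ j $ k * X' k) + Y' j * (C *v X 0) $ j)) (at 0)"
    unfolding p_def pair_def by (intro has_vector_derivative_sum has_vector_derivative_mult dY dCX)
  moreover have "(\<Sum>j\<in>UNIV. Y 0 $ j * (\<Sum>k\<in>UNIV. C $ j $ k * X' k) + Y' j * (C *v X 0) $ j) = 2 * S"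
    by (simp add: sum.distrib X0 Y0 matrix_vector_mult_def axis_sum S_X S_Y)
  ultimately have dp: "(p has_vector_derivative 2 * S) (at 0)" by simp
  have "(q has_vector_derivative (\<Sum>j\<in>UNIV. Y 0 $ j * X' j + Y' j * X 0 $ j)) (at 0)"
    unfolding q_def pair_def by (intro has_vector_derivative_sum has_vector_derivative_mult dX dY)
  moreover have "(\<Sum>j\<in>UNIV. Y 0 $ j * X' j + Y' j * X 0 $ j) = 0"
    by (simp add: sum.distrib X0 Y0 axis_sum) (simp add: X'_def Y'_def)
  ultimately have dq: "(q has_vector_derivative 0) (at 0)" by simp
  have "(inverse has_field_derivative - (inverse (q 0) ^ Suc (Suc 0))) (at (q 0))"
    by (rule DERIV_inverse) (simp add: q0)
  then have "((inverse \<circ> q) has_vector_derivative 0 * - (inverse (q 0) ^ Suc (Suc 0))) (at 0)"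
    by (rule field_vector_diff_chain_at[OF dq])
  then have "((\<lambda>t. p t * (inverse \<circ> q) t) has_vector_derivative 2 * S) (at 0)"
    using has_vector_derivative_mult[OF dp, of "inverse \<circ> q" 0] by (simp add: q0)
  then have second: "((\<lambda>t. p t / q t) has_vector_derivative 2 * S) (at 0)"
    by (simp add: divide_inverse)
  have "\<forall>\<^sub>F t in nhds 0. t \<in> {-e1<..<e1} \<and> t \<in> {-e2<..<e2}"
    using e1 e2 by (intro eventually_conj eventually_nhds_in_open) auto
  with q_ne have "\<forall>\<^sub>F t in nhds 0. (f has_vector_derivative p t / q t) (at t)"
    by eventually_elim (blast intro: deriv)
  with second have "has_second_vector_derivative f (2 * S) 0"
    unfolding has_second_vector_derivative_def by (intro exI[of _ "\<lambda>t. p t / q t"]) simp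
  then show ?thesis
    by (simp add: S_def sum_distrib_left mult.assoc)
qed

section \<open>Eigenvalue branches of a real matrix\<close>

lemma of_real_matrix_component [simp]: "of_real_matrix A $ i $ j = of_real (A $ i $ j)"
  by (simp add: of_real_matrix_def map_matrix_def)

text \<open>Duality says that the matrix with rows \<open>u\<^sub>i\<^sup>*\<close> is inverse to the matrix with columns \<open>v\<^sub>j\<close>.
  Conjugating \<open>A + t B\<close> by them gives \<open>diag l + t C\<close>, where \<open>C\<close> is the matrix of couplings.\<close>

lemma eigenvalue_branch_second_derivative:
  fixes A B :: "real^'n^'n"
  assumes inj: "inj l" and right: "\<And>i. of_real_matrix A *v v i = l i *s v i"
    and dual: "\<And>i j. cdot (u j) (v i) = (if i = j then 1 else 0)"
    and branch: "eigenvalue_branch A B (l i) f"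
  shows "has_second_vector_derivative f (\<Sum>j\<in>-{i}. force l u v B i j) 0"
proof -
  define Q where "Q = (\<chi> j k. cnj (u j $ k))"
  define V where "V = (\<chi> k j. v j $ k)"
  define C where "C = (\<chi> i j. coupling u v B i j)"
  have "Q ** V = mat 1"
    using dual by (simp add: vec_eq_iff Q_def V_def mat_def matrix_matrix_mult_def cdot_def)
  then have VQ: "V ** Q = mat 1" by (simp add: matrix_left_right_inverse)
  have col: "of_real_matrix (A + t *\<^sub>R B) *v v j = l j *s v j + of_real t *s (of_real_matrix B *v v j)" for t j
  proof -
    have "of_real_matrix (A + t *\<^sub>R B) *v v j = of_real_matrix A *v v j + of_real t *s (of_real_matrix B *v v j)"
      by (simp add: vec_eq_iff matrix_vector_mult_def distrib_right sum.distrib sum_distrib_left mult.assoc)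
    then show ?thesis by (simp add: right)
  qed
  have conj: "Q ** (of_real_matrix (A + t *\<^sub>R B) ** V) = perturbed_diagonal l C t" for t
  proof -
    have "(Q ** (of_real_matrix (A + t *\<^sub>R B) ** V)) $ i $ j = cdot (u i) (of_real_matrix (A + t *\<^sub>R B) *v v j)" for i j
      by (simp add: Q_def V_def matrix_matrix_mult_def matrix_vector_mult_def cdot_def)
    also have "\<dots> i j = l j * cdot (u i) (v j) + of_real t * coupling u v B i j" for i j
      unfolding col by (simp add: cdot_def coupling_def distrib_left sum.distrib sum_distrib_left mult_ac)
    finally show ?thesis
      by (simp add: vec_eq_iff perturbed_diagonal_def C_def dual)
  qed
  from branch obtain e where e: "0 < e" and cont: "continuous_on {-e<..<e} f" and f0: "f 0 = l i"
    and eig: "\<And>t. t \<in> {-e<..<e} \<Longrightarrow> eigenvalue (of_real_matrix (A + t *\<^sub>R B)) (f t)"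
    unfolding eigenvalue_branch_def by blast
  have "\<exists>y. y \<noteq> 0 \<and> perturbed_diagonal l C t *v y = f t *s y" if t: "t \<in> {-e<..<e}" for t
  proof -
    obtain x where x: "x \<noteq> 0" "of_real_matrix (A + t *\<^sub>R B) *v x = f t *s x"
      using eig[OF t] unfolding eigenvalue_def right_eigenvector_def by blast
    have VQx: "V *v (Q *v x) = x" by (simp add: matrix_vector_mul_assoc VQ)
    then have "Q *v x \<noteq> 0" using x(1) by auto
    moreover have "perturbed_diagonal l C t *v (Q *v x) = Q *v (of_real_matrix (A + t *\<^sub>R B) *v (V *v (Q *v x)))"
      by (simp only: conj[symmetric] matrix_vector_mul_assoc matrix_mul_assoc)
    then have "perturbed_diagonal l C t *v (Q *v x) = f t *s (Q *v x)"
      by (simp only: VQx x(2) vector_scalar_commute)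
    ultimately show ?thesis by blast
  qed
  from eigenvalue_second_derivative[OF inj e cont f0 this]
  show ?thesis by (simp add: force_def C_def)
qed

section \<open>Eigenvectors of real normal matrices\<close>

text \<open>In the unitary coordinates that diagonalise \<open>A\<close>, an eigenvector is supported on the positions
  where the diagonal entry equals its eigenvalue, so eigenvectors for different eigenvalues
  have disjoint supports.\<close>

lemma normal_eigenvectors_orthogonal:
  assumes "normal_matrix A" and x: "A *v x = a *s x" and y: "A *v y = b *s y" and "a \<noteq> b"
  shows "cdot x y = 0"
proof -
  obtain U D where U: "unitary_matrix U" and D: "diagonal_matrix D" and A: "A = U ** D ** conj_transpose U"
    using \<open>normal_matrix A\<close> unfolding normal_matrix_def by blast
  have U1: "U ** conj_transpose U = mat 1" and U2: "conj_transpose U ** U = mat 1"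
    using U by (auto simp: unitary_matrix_def)
  have coord: "D $ k $ k * (conj_transpose U *v w) $ k = c * (conj_transpose U *v w) $ k"
    if "A *v w = c *s w" for w c k
  proof -
    have "D *v (conj_transpose U *v w) = conj_transpose U *v (A *v w)"
      by (simp add: A matrix_vector_mul_assoc matrix_mul_assoc U2)
    also have "\<dots> = c *s (conj_transpose U *v w)" by (simp add: that vector_scalar_commute)
    finally have "(D *v (conj_transpose U *v w)) $ k = c * (conj_transpose U *v w) $ k" by simp
    moreover have "(D *v z) $ k = D $ k $ k * z $ k" for z
    proof -
      have "(D *v z) $ k = (\<Sum>j\<in>{k}. D $ k $ j * z $ j)"
        unfolding matrix_vector_mult_def vec_lambda_beta
        using D by (intro sum.mono_neutral_right) (auto simp: diagonal_matrix_def)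
      then show ?thesis by simp
    qed
    ultimately show ?thesis by simp
  qed
  have zero: "cnj ((conj_transpose U *v x) $ k) * (conj_transpose U *v y) $ k = 0" for k
    using coord[OF x, of k] coord[OF y, of k] \<open>a \<noteq> b\<close> by auto
  have adjoint: "cdot (conj_transpose U *v x) z = cdot x (U *v z)" for z
    unfolding cdot_def matrix_vector_mult_def conj_transpose_def vec_lambda_beta cnj_sum
      sum_distrib_left sum_distrib_right
    by (subst sum.swap) (simp add: mult_ac)
  \<comment> \<open>The adjoint of \<open>U\<close> preserves the product, so it can be evaluated in the diagonalising coordinates.\<close>
  have "cdot x y = cdot x (U *v (conj_transpose U *v y))"
    by (simp add: matrix_vector_mul_assoc U1)
  also have "\<dots> = cdot (conj_transpose U *v x) (conj_transpose U *v y)" by (simp only: adjoint)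
  also have "\<dots> = 0" unfolding cdot_def by (rule sum.neutral) (simp only: zero, simp)
  finally show ?thesis .
qed

lemma real_matrix_cnj_eigenvector:
  assumes "of_real_matrix M *v x = a *s x"
  shows "of_real_matrix M *v cnj_vec x = cnj a *s cnj_vec x"
proof -
  have "of_real_matrix M *v cnj_vec x = cnj_vec (of_real_matrix M *v x)"
    by (simp add: vec_eq_iff cnj_vec_def matrix_vector_mult_def)
  then show ?thesis by (simp add: assms) (simp add: vec_eq_iff cnj_vec_def)
qed

section \<open>Expected forces\<close>

text \<open>Distinct variables are uncorrelated, so only the diagonal terms of the double sum survive.\<close>

lemma (in prob_space) white_noise_bilinear_expectation:
  fixes X :: "'k::finite \<Rightarrow> 'a \<Rightarrow> real" and \<alpha> \<beta> :: "'k \<Rightarrow> complex"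
  assumes indep: "indep_vars (\<lambda>_. borel) X UNIV"
    and square: "\<And>p. integrable M (\<lambda>\<omega>. X p \<omega> ^ 2)"
    and mean: "\<And>p. expectation (X p) = 0"
    and variance: "\<And>p. expectation (\<lambda>\<omega>. X p \<omega> ^ 2) = s"
  defines "Z \<equiv> \<lambda>\<omega>. (\<Sum>p\<in>UNIV. \<alpha> p * of_real (X p \<omega>)) * (\<Sum>p\<in>UNIV. \<beta> p * of_real (X p \<omega>))"
  shows "integrable M Z" and "integral\<^sup>L M Z = of_real s * (\<Sum>p\<in>UNIV. \<alpha> p * \<beta> p)"
proof -
  have meas [measurable]: "X p \<in> borel_measurable M" for p
    using indep by (simp add: indep_vars_def)
  have int: "integrable M (X p)" for p
    using square_integrable_imp_integrable[OF meas square] .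
  have off: "integrable M (\<lambda>\<omega>. X p \<omega> * X q \<omega>)" "expectation (\<lambda>\<omega>. X p \<omega> * X q \<omega>) = 0" if "p \<noteq> q" for p q
  proof -
    have sub: "indep_vars (\<lambda>_. borel) X {p, q}" by (rule indep_vars_subset[OF indep]) auto
    show "integrable M (\<lambda>\<omega>. X p \<omega> * X q \<omega>)"
      using indep_vars_integrable[OF _ sub] int that by simp
    show "expectation (\<lambda>\<omega>. X p \<omega> * X q \<omega>) = 0"
      using indep_vars_lebesgue_integral[OF _ sub] int that mean by simp
  qed
  have prod: "integrable M (\<lambda>\<omega>. X p \<omega> * X q \<omega>)"
    "expectation (\<lambda>\<omega>. X p \<omega> * X q \<omega>) = (if p = q then s else 0)" for p q
    using off[of p q] square[of p] variance[of p] by (auto simp: power2_eq_square)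
  have Z: "Z = (\<lambda>\<omega>. \<Sum>p\<in>UNIV. \<Sum>q\<in>UNIV. \<alpha> p * \<beta> q * complex_of_real (X p \<omega> * X q \<omega>))"
    by (simp add: Z_def sum_product mult_ac)
  have intZ: "integrable M (\<lambda>\<omega>. \<alpha> p * \<beta> q * complex_of_real (X p \<omega> * X q \<omega>))" for p q
    by (intro integrable_mult_right integrable_of_real prod)
  show "integrable M Z"
    unfolding Z by (intro Bochner_Integration.integrable_sum intZ)
  have "integral\<^sup>L M Z = (\<Sum>p\<in>UNIV. \<Sum>q\<in>UNIV. \<alpha> p * \<beta> q * complex_of_real (if p = q then s else 0))"
    unfolding Z by (simp only: Bochner_Integration.integral_sum Bochner_Integration.integrable_sum intZ
        integral_mult_right_zero integral_complex_of_real prod)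
  also have "\<dots> = of_real s * (\<Sum>p\<in>UNIV. \<alpha> p * \<beta> p)"
    by (simp add: if_distrib[of "\<lambda>a. _ * of_real a"] sum_distrib_left mult_ac cong: if_cong)
  finally show "integral\<^sup>L M Z = of_real s * (\<Sum>p\<in>UNIV. \<alpha> p * \<beta> p)" .
qed

text \<open>The coupling is a linear form in the matrix entries, which are indexed by pairs to match
  the index set over which they are independent.\<close>

lemma coupling_entry_sum:
  "coupling u v B i j = (\<Sum>p\<in>UNIV. (cnj (u i $ fst p) * v j $ snd p) * of_real (B $ fst p $ snd p))"
proof -
  have "coupling u v B i j
      = (\<Sum>a\<in>UNIV. \<Sum>b\<in>UNIV. (cnj (u i $ a) * v j $ b) * of_real (B $ a $ b))"
    by (simp add: coupling_def cdot_def matrix_vector_mult_def sum_distrib_left mult_ac)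
  also have "\<dots> = (\<Sum>p\<in>UNIV. (cnj (u i $ fst p) * v j $ snd p) * of_real (B $ fst p $ snd p))"
    by (simp add: sum.cartesian_product UNIV_Times_UNIV case_prod_beta)
  finally show ?thesis .
qed

text \<open>The sum over pairs of indices factors into a sum over rows, which involves only \<open>u\<close>, and a
  sum over columns, which involves only \<open>v\<close>. The latter is the bilinear, not the
  sesquilinear, product of \<open>v\<^sub>j\<close> and \<open>v\<^sub>i\<close>; this is where complex conjugation comes in.\<close>

lemma (in prob_space) expected_force:
  fixes P :: "'a \<Rightarrow> real^'n^'n"
  assumes indep: "indep_vars (\<lambda>_. borel) (\<lambda>p \<omega>. P \<omega> $ fst p $ snd p) UNIV"
    and square: "\<And>a b. integrable M (\<lambda>\<omega>. (P \<omega> $ a $ b) ^ 2)"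
    and mean: "\<And>a b. expectation (\<lambda>\<omega>. P \<omega> $ a $ b) = 0"
    and variance: "\<And>a b. expectation (\<lambda>\<omega>. (P \<omega> $ a $ b) ^ 2) = s"
  shows "integrable M (\<lambda>\<omega>. force l u v (P \<omega>) i j)"
    and "(\<integral>\<omega>. force l u v (P \<omega>) i j \<partial>M)
      = 2 * of_real s * cdot (u i) (cnj_vec (u j)) * cdot (cnj_vec (v j)) (v i) / (l i - l j)"
proof -
  define Z where "Z \<omega> = coupling u v (P \<omega>) i j * coupling u v (P \<omega>) j i" for \<omega>
  note Z_moments = white_noise_bilinear_expectation[OF indep square mean variance,
      of "\<lambda>p. cnj (u i $ fst p) * v j $ snd p" "\<lambda>p. cnj (u j $ fst p) * v i $ snd p",
      folded coupling_entry_sum Z_def]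
  have force: "force l u v (P \<omega>) i j = 2 * Z \<omega> / (l i - l j)" for \<omega>
    by (simp add: force_def Z_def)
  show "integrable M (\<lambda>\<omega>. force l u v (P \<omega>) i j)"
    unfolding force using Z_moments(1) by simp
  have "(\<Sum>p\<in>UNIV. cnj (u i $ fst p) * v j $ snd p * (cnj (u j $ fst p) * v i $ snd p))
      = (\<Sum>a\<in>UNIV. \<Sum>b\<in>UNIV. (cnj (u i $ a) * cnj (u j $ a)) * (v j $ b * v i $ b))"
    by (simp add: sum.cartesian_product UNIV_Times_UNIV case_prod_beta mult_ac)
  also have "\<dots> = cdot (u i) (cnj_vec (u j)) * cdot (cnj_vec (v j)) (v i)"
    by (simp only: sum_product[symmetric]) (simp add: cdot_def cnj_vec_def)
  finally show "(\<integral>\<omega>. force l u v (P \<omega>) i j \<partial>M)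
      = 2 * of_real s * cdot (u i) (cnj_vec (u j)) * cdot (cnj_vec (v j)) (v i) / (l i - l j)"
    unfolding force using Z_moments by (simp add: mult.assoc)
qed

theorem corollary1:
  fixes M :: "real^'n^'n"
    and l :: "'n \<Rightarrow> complex"
    and u v :: "'n \<Rightarrow> complex^'n"
    and W :: "'w measure"
    and P :: "'w \<Rightarrow> real^'n^'n"
    and L :: "'n \<Rightarrow> 'w \<Rightarrow> real \<Rightarrow> complex"
  assumes normal: "normal_matrix (of_real_matrix M)"
    and spectrum: "bij_betw l UNIV {z. eigenvalue (of_real_matrix M) z}"
    and simple: "\<And>i. simple_eigenvalue (of_real_matrix M) (l i)"
    and right: "\<And>i. right_eigenvector (of_real_matrix M) (v i) (l i)"
    and unit: "\<And>i. norm (v i) = 1"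
    and left: "\<And>i. left_eigenvector (of_real_matrix M) (u i) (l i)"
    and dual: "\<And>i j. cdot (u j) (v i) = (if i = j then 1 else 0)"
    and prob: "prob_space W"
    and indep: "prob_space.indep_vars W (\<lambda>_. borel) (\<lambda>(a, b) \<omega>. P \<omega> $ a $ b) UNIV"
    and ident: "\<And>a b a' b'. distr W borel (\<lambda>\<omega>. P \<omega> $ a $ b) = distr W borel (\<lambda>\<omega>. P \<omega> $ a' $ b')"
    and fourth_moment: "\<And>a b. integrable W (\<lambda>\<omega>. (P \<omega> $ a $ b) ^ 4)"
    and mean_zero: "\<And>a b. prob_space.expectation W (\<lambda>\<omega>. P \<omega> $ a $ b) = 0"
    and branch: "\<And>i \<omega>. \<omega> \<in> space W \<Longrightarrow> eigenvalue_branch M (P \<omega>) (l i) (L i \<omega>)"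
  shows "\<forall>i. \<exists>L''.
           (\<forall>\<omega>\<in>space W. has_second_vector_derivative (L i \<omega>) (L'' \<omega>) 0) \<and>
           integrable W L'' \<and>
           (\<forall>j. j \<noteq> i \<longrightarrow> integrable W (\<lambda>\<omega>. force l u v (P \<omega>) i j)) \<and>
           (\<integral>\<omega>. (\<Sum>j | l j \<noteq> l i \<and> l j \<noteq> cnj (l i). force l u v (P \<omega>) i j) \<partial>W) = 0 \<and>
           (if l i \<in> \<real> then (\<integral>\<omega>. L'' \<omega> \<partial>W) = 0
            else \<exists>j. l j = cnj (l i) \<and>
                   (\<integral>\<omega>. L'' \<omega> \<partial>W) = (\<integral>\<omega>. force l u v (P \<omega>) i j \<partial>W))"
proof
  fix i
  interpret prob_space W by (rule prob)
  let ?F = "\<lambda>\<omega> j. force l u v (P \<omega>) i j"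
  have inj: "inj l" using spectrum by (rule bij_betw_imp_inj_on)
  have v_eig: "of_real_matrix M *v v j = l j *s v j" for j
    using right by (simp add: right_eigenvector_def)
  have indep_pairs: "indep_vars (\<lambda>_. borel) (\<lambda>p \<omega>. P \<omega> $ fst p $ snd p) UNIV"
    using indep by (simp add: case_prod_beta')
  then have meas: "(\<lambda>\<omega>. P \<omega> $ a $ b) \<in> borel_measurable W" for a b
    by (auto simp: indep_vars_def dest!: spec[of _ "(a, b)"])
  have square: "integrable W (\<lambda>\<omega>. (P \<omega> $ a $ b) ^ 2)" for a b
  proof (rule square_integrable_imp_integrable)
    show "(\<lambda>\<omega>. (P \<omega> $ a $ b) ^ 2) \<in> borel_measurable W" using meas by measurable
    show "integrable W (\<lambda>\<omega>. ((P \<omega> $ a $ b)\<^sup>2)\<^sup>2)"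
      using fourth_moment[of a b] by (simp flip: power_mult)
  qed
  have second_moment: "expectation (\<lambda>\<omega>. (P \<omega> $ a $ b) ^ 2)
      = integral\<^sup>L (distr W borel (\<lambda>\<omega>. P \<omega> $ a $ b)) (\<lambda>x. x ^ 2)" for a b
    by (rule integral_distr[symmetric]) (use meas in auto)
  obtain s where s: "\<And>a b. expectation (\<lambda>\<omega>. (P \<omega> $ a $ b) ^ 2) = s"
    unfolding second_moment using ident by metis
  note moments = expected_force[OF indep_pairs square mean_zero s, of l u v i]
  have no_force: "(\<integral>\<omega>. ?F \<omega> j \<partial>W) = 0" if "l j \<noteq> cnj (l i)" for j
  proof -
    \<comment> \<open>The conjugate of \<open>v\<^sub>j\<close> is an eigenvector of the real matrix for \<open>cnj (l j)\<close>; if this differs from \<open>l i\<close>, normality makes it orthogonal to \<open>v\<^sub>i\<close>.\<close>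
    have "cnj (l j) \<noteq> l i" using that by (metis complex_cnj_cnj)
    then have "cdot (cnj_vec (v j)) (v i) = 0"
      by (rule normal_eigenvectors_orthogonal[OF normal real_matrix_cnj_eigenvector[OF v_eig] v_eig])
    then show ?thesis by (simp add: moments)
  qed
  define L'' where "L'' \<omega> = (\<Sum>j\<in>-{i}. ?F \<omega> j)" for \<omega>
  have total: "(\<integral>\<omega>. L'' \<omega> \<partial>W) = (\<Sum>j\<in>-{i}. \<integral>\<omega>. ?F \<omega> j \<partial>W)"
    unfolding L''_def by (rule Bochner_Integration.integral_sum) (rule moments)
  have "has_second_vector_derivative (L i \<omega>) (L'' \<omega>) 0" if "\<omega> \<in> space W" for \<omega>
    unfolding L''_def
    by (rule eigenvalue_branch_second_derivative[OF inj v_eig dual branch[OF that]])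
  moreover have "integrable W L''"
    unfolding L''_def by (intro Bochner_Integration.integrable_sum moments)
  moreover have "(\<integral>\<omega>. (\<Sum>j | l j \<noteq> l i \<and> l j \<noteq> cnj (l i). ?F \<omega> j) \<partial>W) = 0"
    by (simp add: Bochner_Integration.integral_sum moments(1) no_force)
  moreover have "if l i \<in> \<real> then (\<integral>\<omega>. L'' \<omega> \<partial>W) = 0
      else \<exists>j. l j = cnj (l i) \<and> (\<integral>\<omega>. L'' \<omega> \<partial>W) = (\<integral>\<omega>. ?F \<omega> j \<partial>W)"
  proof (cases "l i \<in> \<real>")
    case True
    then have "l j \<noteq> cnj (l i)" if "j \<noteq> i" for j
      using inj that by (simp add: Reals_cnj_iff inj_eq)
    then show ?thesis using True by (simp add: total no_force)
  next
    case False
    have "right_eigenvector (of_real_matrix M) (cnj_vec (v i)) (cnj (l i))"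
      using right[of i] real_matrix_cnj_eigenvector[OF v_eig, of i]
      by (auto simp: right_eigenvector_def vec_eq_iff cnj_vec_def)
    then have "cnj (l i) \<in> range l"
      using spectrum by (auto simp: bij_betw_def eigenvalue_def)
    then obtain j where j: "l j = cnj (l i)" by auto
    have "j \<noteq> i" using j False by (auto simp: Reals_cnj_iff)
    have "(\<Sum>k\<in>-{i}. \<integral>\<omega>. ?F \<omega> k \<partial>W) = (\<Sum>k\<in>{j}. \<integral>\<omega>. ?F \<omega> k \<partial>W)"
      using \<open>j \<noteq> i\<close> inj
      by (intro sum.mono_neutral_right) (auto simp: inj_eq j[symmetric] intro!: no_force)
    then show ?thesis using False j total by auto
  qed
  ultimately show "\<exists>L''.
           (\<forall>\<omega>\<in>space W. has_second_vector_derivative (L i \<omega>) (L'' \<omega>) 0) \<and>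
           integrable W L'' \<and>
           (\<forall>j. j \<noteq> i \<longrightarrow> integrable W (\<lambda>\<omega>. force l u v (P \<omega>) i j)) \<and>
           (\<integral>\<omega>. (\<Sum>j | l j \<noteq> l i \<and> l j \<noteq> cnj (l i). force l u v (P \<omega>) i j) \<partial>W) = 0 \<and>
           (if l i \<in> \<real> then (\<integral>\<omega>. L'' \<omega> \<partial>W) = 0
            else \<exists>j. l j = cnj (l i) \<and>
                   (\<integral>\<omega>. L'' \<omega> \<partial>W) = (\<integral>\<omega>. force l u v (P \<omega>) i j \<partial>W))"
    using moments(1) by blast
qed

end
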